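(* Let $X$ and $Y$ be Banach spaces. If $Z=X\oplus_\infty Y$ has the Ball Small Combination of Slice Property ($BSCSP$), then both $X$ and $Y$ have $BSCSP$.
   Context: Banach spaces $X,Y$ are real and nontrivial; $B_X$ is the closed unit ball of $X$. $X\oplus_\infty Y$ is $X\times Y$ with norm $\|(x,y)\|=\max\{\|x\|,\|y\|\}$. A slice of $B_X$ is a set $S(B_X,x^*,\alpha)=\{x\in B_X: x^*(x)>\sup x^*(B_X)-\alpha\}$ with $x^*\in X^*$, $\|x^*\|=1$, $\alpha>0$. A convex combination of slices of $B_X$ is a set $\sum_{i=1}^n\lambda_i S_i=\{\sum_{i=1}^n\lambda_i s_i: s_i\in S_i\}$ where each $S_i$ is a slice of $B_X$, $0\le\lambda_i\le 1$ and $\sum_{i=1}^n\lambda_i=1$. $X$ has $BSCSP$ if $B_X$ has convex combinations of slices of arbitrarily small diameter (for every $\varepsilon>0$ there is one of diameter less than $\varepsilon$). *)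

theory Defs
  imports "HOL-Analysis.Analysis"
begin

text \<open>The product type of the library carries the Euclidean norm, so the
  \<open>\<ell>\<^sub>\<infinity>\<close>-sum is introduced as a separate type.\<close>

typedef ('a, 'b) linf_sum (infixr \<open>\<oplus>\<^sub>\<infinity>\<close> 20) = "UNIV :: ('a \<times> 'b) set"
  morphisms pair_of_linf Linf ..

definition linf_fst :: "('a \<oplus>\<^sub>\<infinity> 'b) \<Rightarrow> 'a" where
  "linf_fst z = fst (pair_of_linf z)"

definition linf_snd :: "('a \<oplus>\<^sub>\<infinity> 'b) \<Rightarrow> 'b" where
  "linf_snd z = snd (pair_of_linf z)"

lemma linf_fst_Linf [simp]: "linf_fst (Linf (x, y)) = x"
  by (simp add: linf_fst_def Linf_inverse)

lemma linf_snd_Linf [simp]: "linf_snd (Linf (x, y)) = y"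
  by (simp add: linf_snd_def Linf_inverse)

lemma linf_eq_iff: "z = w \<longleftrightarrow> linf_fst z = linf_fst w \<and> linf_snd z = linf_snd w"
  by (metis linf_fst_def linf_snd_def pair_of_linf_inject prod_eq_iff)

instantiation linf_sum :: (real_vector, real_vector) real_vector
begin

definition zero_linf_sum :: "'a \<oplus>\<^sub>\<infinity> 'b" where
  "0 = Linf (0, 0)"

definition plus_linf_sum :: "('a \<oplus>\<^sub>\<infinity> 'b) \<Rightarrow> ('a \<oplus>\<^sub>\<infinity> 'b) \<Rightarrow> ('a \<oplus>\<^sub>\<infinity> 'b)" where
  "z + w = Linf (linf_fst z + linf_fst w, linf_snd z + linf_snd w)"

definition minus_linf_sum :: "('a \<oplus>\<^sub>\<infinity> 'b) \<Rightarrow> ('a \<oplus>\<^sub>\<infinity> 'b) \<Rightarrow> ('a \<oplus>\<^sub>\<infinity> 'b)" where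
  "z - w = Linf (linf_fst z - linf_fst w, linf_snd z - linf_snd w)"

definition uminus_linf_sum :: "('a \<oplus>\<^sub>\<infinity> 'b) \<Rightarrow> ('a \<oplus>\<^sub>\<infinity> 'b)" where
  "- z = Linf (- linf_fst z, - linf_snd z)"

definition scaleR_linf_sum :: "real \<Rightarrow> ('a \<oplus>\<^sub>\<infinity> 'b) \<Rightarrow> ('a \<oplus>\<^sub>\<infinity> 'b)" where
  "r *\<^sub>R z = Linf (r *\<^sub>R linf_fst z, r *\<^sub>R linf_snd z)"

instance
  by standard
    (simp_all add: linf_eq_iff zero_linf_sum_def plus_linf_sum_def minus_linf_sum_def
      uminus_linf_sum_def scaleR_linf_sum_def algebra_simps)

end

lemma linf_fst_simps [simp]:
  "linf_fst 0 = 0" "linf_fst (z + w) = linf_fst z + linf_fst w"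
  "linf_fst (z - w) = linf_fst z - linf_fst w" "linf_fst (- z) = - linf_fst z"
  "linf_fst (r *\<^sub>R z) = r *\<^sub>R linf_fst z"
  by (simp_all add: zero_linf_sum_def plus_linf_sum_def minus_linf_sum_def
      uminus_linf_sum_def scaleR_linf_sum_def)

lemma linf_snd_simps [simp]:
  "linf_snd 0 = 0" "linf_snd (z + w) = linf_snd z + linf_snd w"
  "linf_snd (z - w) = linf_snd z - linf_snd w" "linf_snd (- z) = - linf_snd z"
  "linf_snd (r *\<^sub>R z) = r *\<^sub>R linf_snd z"
  by (simp_all add: zero_linf_sum_def plus_linf_sum_def minus_linf_sum_def
      uminus_linf_sum_def scaleR_linf_sum_def)

instantiation linf_sum :: (real_normed_vector, real_normed_vector) real_normed_vector
begin

definition norm_linf_sum :: "('a \<oplus>\<^sub>\<infinity> 'b) \<Rightarrow> real" where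
  "norm z = max (norm (linf_fst z)) (norm (linf_snd z))"

definition sgn_linf_sum :: "('a \<oplus>\<^sub>\<infinity> 'b) \<Rightarrow> ('a \<oplus>\<^sub>\<infinity> 'b)" where
  "sgn (z :: 'a \<oplus>\<^sub>\<infinity> 'b) = z /\<^sub>R norm z"

definition dist_linf_sum :: "('a \<oplus>\<^sub>\<infinity> 'b) \<Rightarrow> ('a \<oplus>\<^sub>\<infinity> 'b) \<Rightarrow> real" where
  "dist (z :: 'a \<oplus>\<^sub>\<infinity> 'b) w = norm (z - w)"

definition uniformity_linf_sum :: "(('a \<oplus>\<^sub>\<infinity> 'b) \<times> ('a \<oplus>\<^sub>\<infinity> 'b)) filter" where
  "uniformity_linf_sum =
    (INF e\<in>{0<..}. principal {(z :: 'a \<oplus>\<^sub>\<infinity> 'b, w). dist z w < e})"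

definition open_linf_sum :: "('a \<oplus>\<^sub>\<infinity> 'b) set \<Rightarrow> bool" where
  "open_linf_sum U \<longleftrightarrow> (\<forall>z\<in>U. \<forall>\<^sub>F (z', w) in uniformity. z' = z \<longrightarrow> w \<in> U)"

instance
proof
  fix z w :: "'a \<oplus>\<^sub>\<infinity> 'b" and r :: real and U :: "('a \<oplus>\<^sub>\<infinity> 'b) set"
  show "norm (z + w) \<le> norm z + norm w"
    using norm_triangle_ineq[of "linf_fst z" "linf_fst w"]
      norm_triangle_ineq[of "linf_snd z" "linf_snd w"]
    by (auto simp: norm_linf_sum_def max_def)
  show "norm (r *\<^sub>R z) = \<bar>r\<bar> * norm z"
    by (simp add: norm_linf_sum_def max_mult_distrib_left)
  show "norm z = 0 \<longleftrightarrow> z = 0"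
    by (auto simp: norm_linf_sum_def linf_eq_iff max_def)
qed (simp_all add: sgn_linf_sum_def dist_linf_sum_def uniformity_linf_sum_def open_linf_sum_def)

end

instance linf_sum :: (banach, banach) banach
proof
  fix Z :: "nat \<Rightarrow> 'a \<oplus>\<^sub>\<infinity> 'b"
  assume Z: "Cauchy Z"
  have fst_le: "norm (linf_fst z) \<le> norm z" and snd_le: "norm (linf_snd z) \<le> norm z"
    for z :: "'a \<oplus>\<^sub>\<infinity> 'b"
    by (simp_all add: norm_linf_sum_def)
  have "Cauchy (\<lambda>n. linf_fst (Z n))"
    using Z unfolding Cauchy_iff by (metis fst_le linf_fst_simps(3) order_le_less_trans)
  then obtain x where x: "(\<lambda>n. linf_fst (Z n)) \<longlonglongrightarrow> x"
    using Cauchy_convergent convergent_def by blast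
  have "Cauchy (\<lambda>n. linf_snd (Z n))"
    using Z unfolding Cauchy_iff by (metis snd_le linf_snd_simps(3) order_le_less_trans)
  then obtain y where y: "(\<lambda>n. linf_snd (Z n)) \<longlonglongrightarrow> y"
    using Cauchy_convergent convergent_def by blast
  have "(\<lambda>n. max (norm (linf_fst (Z n) - x)) (norm (linf_snd (Z n) - y))) \<longlonglongrightarrow> max 0 0"
    by (intro tendsto_max tendsto_norm_zero LIM_zero x y)
  then have "(\<lambda>n. norm (Z n - Linf (x, y))) \<longlonglongrightarrow> 0"
    by (simp add: norm_linf_sum_def)
  then have "Z \<longlonglongrightarrow> Linf (x, y)"
    by (simp add: tendsto_norm_zero_iff LIM_zero_iff)
  then show "convergent Z"
    by (rule convergentI)
qed

definition slice :: "'a::real_normed_vector set \<Rightarrow> ('a \<Rightarrow>\<^sub>L real) \<Rightarrow> real \<Rightarrow> 'a set" where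
  "slice C f \<alpha> = {x \<in> C. blinfun_apply f x > (SUP y\<in>C. blinfun_apply f y) - \<alpha>}"

definition is_ball_slice :: "'a::real_normed_vector set \<Rightarrow> bool" where
  "is_ball_slice S \<longleftrightarrow> (\<exists>f \<alpha>. norm f = 1 \<and> \<alpha> > 0 \<and> S = slice (cball 0 1) f \<alpha>)"

definition is_slice_combination :: "'a::real_normed_vector set \<Rightarrow> bool" where
  "is_slice_combination D \<longleftrightarrow>
    (\<exists>(n::nat) (c :: nat \<Rightarrow> real) (S :: nat \<Rightarrow> 'a set).
      (\<forall>i<n. is_ball_slice (S i) \<and> 0 \<le> c i \<and> c i \<le> 1) \<and>
      (\<Sum>i<n. c i) = 1 \<and>
      D = {\<Sum>i<n. c i *\<^sub>R s i | s. \<forall>i<n. s i \<in> S i})"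

text \<open>A property of the space, hence a predicate on the type. The set \<open>D\<close> is bounded and
  nonempty, so \<^const>\<open>diameter\<close> takes no default value.\<close>

definition BSCSP :: "'a::real_normed_vector itself \<Rightarrow> bool" where
  "BSCSP _ \<longleftrightarrow> (\<forall>\<epsilon>>0. \<exists>D :: 'a set. is_slice_combination D \<and> diameter D < \<epsilon>)"

end

theory Submission
  imports Defs
begin

text \<open>
  A slice \<open>S\<close> of the ball of \<open>Z = X \<oplus>\<^sub>\<infinity> Y\<close>, cut out by a functional \<open>f\<close>, contains a copy
  \<open>T \<times> {y}\<close> of a slice \<open>T\<close> of the ball of \<open>X\<close>: the ball of \<open>Z\<close> is a product, so if
  \<open>f\<close> is nearly maximal at \<open>(x, y)\<close>, it stays nearly maximal when \<open>x\<close> is replaced by any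
  point at which the restriction \<open>f(\<cdot>, 0)\<close> is nearly maximal
  (\<open>ball_slice_contains_slice_copy\<close>). Convex combinations respect this: a combination \<open>D\<close> of
  slices of the ball of \<open>Z\<close> contains an isometric copy, translated along \<open>Y\<close>, of the
  combination of the corresponding slices \<open>T\<close> with the same coefficients. So the latter has no
  larger diameter than \<open>D\<close>.

  The one obstruction is that \<open>f(\<cdot>, 0)\<close> may vanish, in which case \<open>T\<close> is the whole ball
  rather than a slice. If this happens for some but not all of the slices that form \<open>D\<close>, the ball
  may be replaced by any slice at all, and a nonzero restriction coming from another index supplies
  one. If it happens for all of them, \<open>D\<close> contains a copy of the ball of \<open>X\<close>; this has
  diameter 2, as \<open>X\<close> is nontrivial, so it is excluded as soon as \<open>D\<close> has diameter less than 1.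

  For the symmetry between \<open>X\<close> and \<open>Y\<close>, the argument
  (\<open>BSCSP_linf_summand\<close>) is phrased for two linear maps into \<open>Z\<close> that exhibit it as an
  \<open>\<ell>\<^sub>\<infinity>\<close>-sum.
\<close>

lemma bdd_above_blinfun_cball:
  fixes f :: "'a::real_normed_vector \<Rightarrow>\<^sub>L real"
  shows "bdd_above (blinfun_apply f ` cball 0 1)"
proof (rule bdd_aboveI2)
  fix x :: 'a assume "x \<in> cball 0 1"
  then have "norm f * norm x \<le> norm f * 1"
    by (intro mult_left_mono) auto
  then show "blinfun_apply f x \<le> norm f"
    using norm_blinfun[of f x] by (simp add: abs_le_iff)
qed

lemma slice_memD:
  fixes f :: "'a::real_normed_vector \<Rightarrow>\<^sub>L real"
  assumes "x \<in> slice (cball 0 1) f \<alpha>" "norm y \<le> 1"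
  shows "norm x \<le> 1" "blinfun_apply f y < blinfun_apply f x + \<alpha>"
proof -
  have "blinfun_apply f y \<le> (SUP y\<in>cball 0 1. blinfun_apply f y)"
    using assms(2) by (intro cSUP_upper bdd_above_blinfun_cball) auto
  then show "norm x \<le> 1" "blinfun_apply f y < blinfun_apply f x + \<alpha>"
    using assms(1) by (auto simp: slice_def)
qed

lemma slice_nonempty:
  fixes f :: "'a::real_normed_vector \<Rightarrow>\<^sub>L real"
  assumes "\<alpha> > 0"
  obtains x where "x \<in> slice (cball 0 1) f \<alpha>"
proof -
  have "\<exists>x\<in>cball 0 1. (SUP y\<in>cball 0 1. blinfun_apply f y) - \<alpha> < blinfun_apply f x"
    using assms by (subst less_cSUP_iff[symmetric]) (auto intro: bdd_above_blinfun_cball)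
  then show ?thesis
    using that by (auto simp: slice_def)
qed

lemma slice_zero_functional:
  assumes "\<alpha> > 0"
  shows "slice (cball 0 1) (0 :: 'a::real_normed_vector \<Rightarrow>\<^sub>L real) \<alpha> = cball 0 1"
  using assms by (auto simp: slice_def)

lemma slice_scaleR:
  fixes f :: "'a::real_normed_vector \<Rightarrow>\<^sub>L real"
  assumes "r > 0"
  shows "slice (cball 0 1) (r *\<^sub>R f) (r * \<alpha>) = slice (cball 0 1) f \<alpha>"
proof -
  let ?B = "cball 0 1 :: 'a set"
  have "(SUP y\<in>?B. r * blinfun_apply f y) = r * (SUP y\<in>?B. blinfun_apply f y)"
  proof (rule antisym)
    show "(SUP y\<in>?B. r * blinfun_apply f y) \<le> r * (SUP y\<in>?B. blinfun_apply f y)"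
      using assms by (intro cSUP_least mult_left_mono cSUP_upper bdd_above_blinfun_cball) auto
    have "(SUP y\<in>?B. blinfun_apply f y) \<le> (SUP y\<in>?B. r * blinfun_apply f y) / r"
    proof (rule cSUP_least)
      fix y assume "y \<in> ?B"
      then have "r * blinfun_apply f y \<le> (SUP y\<in>?B. r * blinfun_apply f y)"
        using bdd_above_blinfun_cball[of "r *\<^sub>R f"]
        by (intro cSUP_upper) (auto simp: blinfun.scaleR_left)
      then show "blinfun_apply f y \<le> (SUP y\<in>?B. r * blinfun_apply f y) / r"
        using assms by (simp add: field_simps)
    qed auto
    then show "r * (SUP y\<in>?B. blinfun_apply f y) \<le> (SUP y\<in>?B. r * blinfun_apply f y)"
      using assms by (simp add: field_simps)
  qed
  then have "slice ?B (r *\<^sub>R f) (r * \<alpha>)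
      = {x \<in> ?B. r * blinfun_apply f x > r * ((SUP y\<in>?B. blinfun_apply f y) - \<alpha>)}"
    by (simp add: slice_def blinfun.scaleR_left right_diff_distrib)
  also have "\<dots> = slice ?B f \<alpha>"
    using assms by (simp add: slice_def)
  finally show ?thesis .
qed

lemma is_ball_slice_slice:
  fixes f :: "'a::real_normed_vector \<Rightarrow>\<^sub>L real"
  assumes "f \<noteq> 0" "\<alpha> > 0"
  shows "is_ball_slice (slice (cball 0 1) f \<alpha>)"
  unfolding is_ball_slice_def
proof (intro exI conjI)
  show "norm (inverse (norm f) *\<^sub>R f) = 1" "inverse (norm f) * \<alpha> > 0"
    using assms by auto
  show "slice (cball 0 1) f \<alpha> = slice (cball 0 1) (inverse (norm f) *\<^sub>R f) (inverse (norm f) * \<alpha>)"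
    using assms by (subst slice_scaleR) auto
qed

lemma bounded_slice_combination:
  fixes D :: "'a::real_normed_vector set"
  assumes "is_slice_combination D"
  shows "bounded D"
proof -
  obtain n :: nat and c :: "nat \<Rightarrow> real" and S :: "nat \<Rightarrow> 'a set"
    where S: "\<forall>k<n. is_ball_slice (S k) \<and> 0 \<le> c k \<and> c k \<le> 1" and c: "(\<Sum>k<n. c k) = 1"
      and D: "D = {\<Sum>k<n. c k *\<^sub>R s k | s. \<forall>k<n. s k \<in> S k}"
    using assms unfolding is_slice_combination_def by blast
  have "norm (\<Sum>k<n. c k *\<^sub>R s k) \<le> 1" if s: "\<forall>k<n. s k \<in> S k" for s
  proof -
    have "norm (s k) \<le> 1" if "k < n" for k
      using s S that by (fastforce simp: is_ball_slice_def slice_def)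
    then have "(\<Sum>k<n. norm (c k *\<^sub>R s k)) \<le> (\<Sum>k<n. c k)"
      using S by (intro sum_mono) (auto intro: mult_left_le)
    then show ?thesis
      using norm_sum[of "\<lambda>k. c k *\<^sub>R s k" "{..<n}"] c by simp
  qed
  then show ?thesis
    by (auto simp: bounded_iff D)
qed

text \<open>Halving \<open>\<alpha>\<close> splits the error: the chosen point \<open>i x + j y\<close> loses less than
  \<open>\<alpha> / 2\<close> against the supremum of \<open>f\<close>, and a point of the smaller slice loses less than
  \<open>\<alpha> / 2\<close> against \<open>x\<close>. The ball is stable under exchanging the first component because of the
  maximum norm.\<close>

lemma ball_slice_contains_slice_copy:
  fixes i :: "'a::real_normed_vector \<Rightarrow> 'z::real_normed_vector"
    and j :: "'b::real_normed_vector \<Rightarrow> 'z"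
  assumes i: "bounded_linear i"
    and norm_ij: "\<And>x y. norm (i x + j y) = max (norm x) (norm y)"
    and surj: "\<And>z. \<exists>x y. z = i x + j y"
    and S: "is_ball_slice S"
  obtains g :: "'a \<Rightarrow>\<^sub>L real" and \<beta> y
  where "\<beta> > 0" "\<And>x. x \<in> slice (cball 0 1) g \<beta> \<Longrightarrow> i x + j y \<in> S"
proof -
  obtain f :: "'z \<Rightarrow>\<^sub>L real" and \<alpha> where \<alpha>: "\<alpha> > 0" and S_eq: "S = slice (cball 0 1) f \<alpha>"
    using S by (auto simp: is_ball_slice_def)
  obtain z where z: "z \<in> slice (cball 0 1) f (\<alpha> / 2)"
    using \<alpha> slice_nonempty[of "\<alpha> / 2" f] by auto
  obtain x y where xy: "z = i x + j y"
    using surj by blast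
  define g where "g = Blinfun (\<lambda>x. blinfun_apply f (i x))"
  have g: "blinfun_apply g x = blinfun_apply f (i x)" for x
    unfolding g_def
    by (simp add: bounded_linear_Blinfun_apply bounded_linear_compose[OF blinfun.bounded_linear_right i])
  have norm_z: "norm x \<le> 1" "norm y \<le> 1"
    using slice_memD(1)[OF z, of z] z norm_ij[of x y] by (auto simp: xy slice_def)
  have "i x' + j y \<in> S" if x': "x' \<in> slice (cball 0 1) g (\<alpha> / 2)" for x'
  proof -
    have "norm x' \<le> 1" "blinfun_apply f (i x) < blinfun_apply f (i x') + \<alpha> / 2"
      using slice_memD[OF x' norm_z(1)] by (auto simp: g)
    then have "norm (i x' + j y) \<le> 1"
      "blinfun_apply f z < blinfun_apply f (i x' + j y) + \<alpha> / 2"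
      using norm_z by (auto simp: norm_ij xy blinfun.add_right)
    then show ?thesis
      using z by (auto simp: S_eq slice_def)
  qed
  then show ?thesis
    using that[of "\<alpha> / 2" g y] \<alpha> by auto
qed

lemma BSCSP_linf_summand:
  fixes i :: "'a::real_normed_vector \<Rightarrow> 'z::real_normed_vector"
    and j :: "'b::real_normed_vector \<Rightarrow> 'z"
  assumes i: "linear i" and j: "linear j"
    and norm_ij: "\<And>x y. norm (i x + j y) = max (norm x) (norm y)"
    and surj: "\<And>z. \<exists>x y. z = i x + j y"
    and nontriv: "\<exists>x :: 'a. x \<noteq> 0"
    and Z: "BSCSP TYPE('z)"
  shows "BSCSP TYPE('a)"
  unfolding BSCSP_def
proof (intro allI impI)
  fix \<epsilon> :: real assume "\<epsilon> > 0"
  have norm_i: "norm (i x) = norm x" for x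
    using norm_ij[of x 0] by (simp add: linear_0[OF j])
  have bl_i: "bounded_linear i"
    using i norm_i by (intro linear_conv_bounded_linear[THEN iffD1] bounded_linear_intro[where K=1])
      (auto simp: linear_add linear_scale)
  \<comment> \<open>The bound 1 is the distance from the centre of a ball to its sphere, so that \<open>D\<close> cannot
    contain a copy of the ball of \<open>X\<close>.\<close>
  have "min \<epsilon> 1 > 0"
    using \<open>\<epsilon> > 0\<close> by simp
  then obtain D :: "'z set" where D_comb: "is_slice_combination D" and D_diam: "diameter D < min \<epsilon> 1"
    using Z unfolding BSCSP_def by blast
  obtain n :: nat and c :: "nat \<Rightarrow> real" and S :: "nat \<Rightarrow> 'z set"
    where S: "\<forall>k<n. is_ball_slice (S k) \<and> 0 \<le> c k \<and> c k \<le> 1" and c: "(\<Sum>k<n. c k) = 1"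
      and D: "D = {\<Sum>k<n. c k *\<^sub>R s k | s. \<forall>k<n. s k \<in> S k}"
    using D_comb unfolding is_slice_combination_def by blast
  have "\<exists>g \<beta> y. k < n \<longrightarrow> \<beta> > 0 \<and> (\<forall>x\<in>slice (cball 0 1) g \<beta>. i x + j y \<in> S k)" for k
    using ball_slice_contains_slice_copy[OF bl_i norm_ij surj, of "S k"] S by metis
  then obtain G B y where B: "\<And>k. k < n \<Longrightarrow> B k > 0"
    and G: "\<And>k x. k < n \<Longrightarrow> x \<in> slice (cball 0 1) (G k) (B k) \<Longrightarrow> i x + j (y k) \<in> S k"
    by metis
  define p where "p = (\<Sum>k<n. c k *\<^sub>R j (y k))"
  have copy: "i (\<Sum>k<n. c k *\<^sub>R x k) + p \<in> D"
    if "\<And>k. k < n \<Longrightarrow> x k \<in> slice (cball 0 1) (G k) (B k)" for x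
  proof -
    have "i (\<Sum>k<n. c k *\<^sub>R x k) + p = (\<Sum>k<n. c k *\<^sub>R (i (x k) + j (y k)))"
      by (simp add: p_def linear_sum[OF i] linear_scale[OF i] scaleR_add_right sum.distrib)
    then show ?thesis
      using G that by (auto simp: D)
  qed
  have dist_le: "norm (x - x') \<le> diameter D" if "i x + p \<in> D" "i x' + p \<in> D" for x x'
  proof -
    have "norm (x - x') = dist (i x + p) (i x' + p)"
      by (simp add: dist_norm norm_i flip: linear_diff[OF i])
    then show ?thesis
      using diameter_bounded_bound[OF bounded_slice_combination[OF D_comb] that] by simp
  qed
  have "\<exists>k<n. G k \<noteq> 0"
  proof (rule ccontr)
    assume "\<not> (\<exists>k<n. G k \<noteq> 0)"
    then have ball: "i x + p \<in> D" if "norm x \<le> 1" for x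
      using copy[of "\<lambda>_. x"] that B
      by (auto simp: slice_zero_functional c simp flip: scaleR_left.sum)
    obtain x :: 'a where "x \<noteq> 0"
      using nontriv by blast
    then have "norm (sgn x) = 1"
      by (simp add: norm_sgn)
    then have "norm (sgn x - 0) \<le> diameter D"
      by (intro dist_le ball) auto
    then show False
      using D_diam \<open>norm (sgn x) = 1\<close> by simp
  qed
  then obtain g :: "'a \<Rightarrow>\<^sub>L real" where g: "g \<noteq> 0"
    by blast
  \<comment> \<open>Where \<open>G k\<close> vanishes, its slice is the whole ball, and any slice lies inside it.\<close>
  define T where "T k = (if G k = 0 then slice (cball 0 1) g 1 else slice (cball 0 1) (G k) (B k))" for k
  have T_slice: "is_ball_slice (T k)" if "k < n" for k
    using B[OF that] g by (auto simp: T_def intro: is_ball_slice_slice)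
  have T_sub: "T k \<subseteq> slice (cball 0 1) (G k) (B k)" if "k < n" for k
    using B[OF that] by (auto simp: T_def slice_zero_functional) (auto simp: slice_def)
  have T_ne: "\<exists>x. x \<in> T k" if "k < n" for k
    using slice_nonempty[of 1 g] slice_nonempty[OF B[OF that]] unfolding T_def by (metis zero_less_one)
  define E where "E = {\<Sum>k<n. c k *\<^sub>R s k | s. \<forall>k<n. s k \<in> T k}"
  have "is_slice_combination E"
    unfolding is_slice_combination_def E_def using S T_slice c by blast
  moreover have "diameter E \<le> diameter D"
  proof (rule diameter_le)
    obtain s where "\<forall>k<n. s k \<in> T k"
      using T_ne by metis
    then show "E \<noteq> {} \<or> 0 \<le> diameter D"
      by (auto simp: E_def)
    show "norm (x - x') \<le> diameter D" if "x \<in> E" "x' \<in> E" for x x'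
      using that T_sub by (intro dist_le) (auto simp: E_def intro!: copy)
  qed
  ultimately show "\<exists>D :: 'a set. is_slice_combination D \<and> diameter D < \<epsilon>"
    using D_diam by force
qed

theorem proposition2p15:
  assumes "\<exists>x :: 'a::banach. x \<noteq> 0"
    and "\<exists>y :: 'b::banach. y \<noteq> 0"
    and "BSCSP TYPE('a \<oplus>\<^sub>\<infinity> 'b)"
  shows "BSCSP TYPE('a) \<and> BSCSP TYPE('b)"
proof -
  let ?i = "\<lambda>x. Linf (x, 0) :: 'a \<oplus>\<^sub>\<infinity> 'b" and ?j = "\<lambda>y. Linf (0, y) :: 'a \<oplus>\<^sub>\<infinity> 'b"
  have lin: "linear ?i" "linear ?j"
    by (auto intro!: linearI simp: linf_eq_iff)
  have norm: "norm (?i x + ?j y) = max (norm x) (norm y)"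
    "norm (?j y + ?i x) = max (norm y) (norm x)" for x y
    by (simp_all add: norm_linf_sum_def max.commute)
  have "z = ?i (linf_fst z) + ?j (linf_snd z)" "z = ?j (linf_snd z) + ?i (linf_fst z)" for z
    by (simp_all add: linf_eq_iff)
  then have surj: "\<exists>x y. z = ?i x + ?j y" "\<exists>y x. z = ?j y + ?i x" for z
    by blast+
  show ?thesis
    using BSCSP_linf_summand[OF lin norm(1) surj(1) assms(1,3)]
      BSCSP_linf_summand[OF lin(2,1) norm(2) surj(2) assms(2,3)] by blast
qed

end
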